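(* Assume that the hypotheses (H0), (H1) and (H2) stated in the context hold, with $M>0$ the constant of (H1). Let $\theta\in[0,1]$ be the parameter of the minmod slope limiter and $\alpha,\beta\in\bigl(0,\tfrac{1}{3(1+\theta)}\bigr)$ the coefficients of the numerical fluxes. Put $\bar\alpha:=2\alpha$, $\bar\beta:=2\beta$, $\bar\lambda_x:=2\lambda_x=2\Delta t/\Delta x$, $\bar\lambda_y:=2\lambda_y=2\Delta t/\Delta y$, and assume that for all $k\in\{1,\dots,N\}$ the time-step $\Delta t>0$ satisfies the CFL conditions $$\bar\lambda_x\le\frac{\min\{1,\;4-6\bar\alpha(1+\theta),\;6\bar\alpha\}}{6(1+\theta)\|\partial_\rho f^k\|+1},\qquad \bar\lambda_y\le\frac{\min\{1,\;4-6\bar\beta(1+\theta),\;6\bar\beta\}}{6(1+\theta)\|\partial_\rho g^k\|+1}.$$ Assume additionally that the mesh sizes satisfy $\Delta x,\Delta y\le\frac{1}{3M}$. If the initial datum satisfies $\boldsymbol\rho_0\in(\mathrm L^1\cap\mathrm L^\infty)(\mathbb R^2;\mathbb R_+^N)$, then the approximate solution $\boldsymbol\rho_\Delta=(\rho_\Delta^1,\dots,\rho_\Delta^N)$ produced by the second-order scheme defined in the context satisfies $\rho_\Delta^k(t,x,y)\ge0$ for all $k\in\{1,\dots,N\}$, all $t\in\mathbb R_+$ and all $(x,y)\in\mathbb R^2$.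
   Context: **Notation.** $\mathbb R_+=[0,\infty)$, $\mathbb R_+^N=[0,\infty)^N$; $\|\cdot\|$ denotes the $\mathrm L^\infty$ (sup) norm (over the whole domain of definition for functions; the maximum norm for vectors in $\mathbb R^m$). **Problem.** Fix integers $N,m\ge1$. For $k=1,\dots,N$ consider the non-local system in two space dimensions $$\partial_t\rho^k+\partial_x f^k(t,x,y,\rho^k,\boldsymbol\eta*\boldsymbol\rho)+\partial_y g^k(t,x,y,\rho^k,\boldsymbol\nu*\boldsymbol\rho)=0,\qquad \boldsymbol\rho(0,\cdot)=\boldsymbol\rho_0=(\rho_0^1,\dots,\rho_0^N),$$ where $\boldsymbol\eta=(\eta^{q,k})$ and $\boldsymbol\nu=(\nu^{q,k})$ are $m\times N$ matrices of functions $\mathbb R^2\to\mathbb R$ and $(\boldsymbol\eta*\boldsymbol\rho)_q=\sum_{k=1}^N\eta^{q,k}*\rho^k$ (convolution in space), similarly for $\boldsymbol\nu$. **Hypotheses.** (H0) For each $k$: $f^k,g^k\in \mathrm C^2(\mathbb R_+\times\mathbb R^2\times\mathbb R\times\mathbb R^m;\mathbb R)$; $\partial_\rho f^k,\partial_\rho g^k\in \mathrm L^\infty(\mathbb R_+\times\mathbb R^2\times\mathbb R\times\mathbb R^m;\mathbb R)$; and $f^k(t,x,y,0,\boldsymbol A)=g^k(t,x,y,0,\boldsymbol B)=0$ for all $t\in\mathbb R_+$, $(x,y)\in\mathbb R^2$, $\boldsymbol A,\boldsymbol B\in\mathbb R^m$. (H1) There is $M>0$ such that for all $k$ and all arguments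 $(t,x,y,\rho,\boldsymbol A)$, resp. $(t,x,y,\rho,\boldsymbol B)$: $|\partial_xf^k|\le M|\rho|$, $\|\nabla_{\boldsymbol A}f^k\|\le M|\rho|$, $|\partial_yg^k|\le M|\rho|$, $\|\nabla_{\boldsymbol B}g^k\|\le M|\rho|$. (H2) $\boldsymbol\eta,\boldsymbol\nu\in(\mathrm C^2\cap \mathrm W^{1,\infty})(\mathbb R^2;\mathbb R^{m\times N})$. **Mesh.** For $\Delta x,\Delta y,\Delta t>0$: $x_i=i\Delta x$, $x_{i+\frac12}=(i+\frac12)\Delta x$, $y_j=j\Delta y$, $y_{j+\frac12}=(j+\frac12)\Delta y$ ($i,j\in\mathbb Z$), $t^n=n\Delta t$ ($n=0,1,2,\dots$), $\lambda_x=\Delta t/\Delta x$, $\lambda_y=\Delta t/\Delta y$. Initial cell averages: $\rho^{k,0}_{i,j}=\frac1{\Delta x\Delta y}\int_{x_{i-1/2}}^{x_{i+1/2}}\int_{y_{j-1/2}}^{y_{j+1/2}}\rho_0^k(x,y)\,dy\,dx$. **Reconstruction.** $\mathrm{minmod}(a_1,\dots,a_p)=\mathrm{sgn}(a_1)\min_l|a_l|$ if $\mathrm{sgn}(a_1)=\dots=\mathrm{sgn}(a_p)$, and $0$ otherwise. For a grid function $(\rho_{i,j})$ and a parameter $\theta\in[0,1]$ set $\sigma^x_{i,j}=2\theta\,\mathrm{minmod}\bigl(\rho_{i,j}-\rho_{i-1,j},\tfrac12(\rho_{i+1,j}-\rho_{i-1,j}),\rho_{i+1,j}-\rho_{i,j}\bigr)$,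 $\sigma^y_{i,j}=2\theta\,\mathrm{minmod}\bigl(\rho_{i,j}-\rho_{i,j-1},\tfrac12(\rho_{i,j+1}-\rho_{i,j-1}),\rho_{i,j+1}-\rho_{i,j}\bigr)$, and face values $\rho^-_{i+\frac12,j}=\rho_{i,j}+\frac12\sigma^x_{i,j}$, $\rho^+_{i-\frac12,j}=\rho_{i,j}-\frac12\sigma^x_{i,j}$, $\rho^-_{i,j+\frac12}=\rho_{i,j}+\frac12\sigma^y_{i,j}$, $\rho^+_{i,j-\frac12}=\rho_{i,j}-\frac12\sigma^y_{i,j}$. **Numerical fluxes.** Given grid functions $\boldsymbol\rho=(\rho^k_{i,j})$ and a time $\tau$, define the discrete convolutions, for $q=1,\dots,m$, $A^q_{i+\frac12,j}=\Delta x\Delta y\sum_{k=1}^N\sum_{l,p\in\mathbb Z}\eta^{q,k}(x_{i+\frac12}-x_l,y_j-y_p)\rho^k_{l,p}$, $\;B^q_{i,j+\frac12}=\Delta x\Delta y\sum_{k=1}^N\sum_{l,p\in\mathbb Z}\nu^{q,k}(x_i-x_l,y_{j+\frac12}-y_p)\rho^k_{l,p}$, $f^k_{i+\frac12,j}(u)=f^k(\tau,x_{i+\frac12},y_j,u,\boldsymbol A_{i+\frac12,j})$, $g^k_{i,j+\frac12}(u)=g^k(\tau,x_i,y_{j+\frac12},u,\boldsymbol B_{i,j+\frac12})$, and with fixed coefficients $\alpha,\beta$ $$F^k_{i+\frac12,j}(u,v)=\tfrac12\bigl(f^k_{i+\frac12,j}(u)+f^k_{i+\frac12,j}(v)\bigr)-\tfrac{\alpha(v-u)}{2\lambda_x},\quad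 G^k_{i,j+\frac12}(u,v)=\tfrac12\bigl(g^k_{i,j+\frac12}(u)+g^k_{i,j+\frac12}(v)\bigr)-\tfrac{\beta(v-u)}{2\lambda_y}.$$ **Euler step.** Given $\boldsymbol\rho$ and $\tau$, with face values and fluxes computed from them, let $\mathcal E_\tau(\boldsymbol\rho)$ be the grid function with components $$\rho^k_{i,j}-\lambda_x\bigl[F^k_{i+\frac12,j}(\rho^{k,-}_{i+\frac12,j},\rho^{k,+}_{i+\frac12,j})-F^k_{i-\frac12,j}(\rho^{k,-}_{i-\frac12,j},\rho^{k,+}_{i-\frac12,j})\bigr]-\lambda_y\bigl[G^k_{i,j+\frac12}(\rho^{k,-}_{i,j+\frac12},\rho^{k,+}_{i,j+\frac12})-G^k_{i,j-\frac12}(\rho^{k,-}_{i,j-\frac12},\rho^{k,+}_{i,j-\frac12})\bigr].$$ **Second-order scheme.** $\boldsymbol\rho^{(1)}=\mathcal E_{t^n}(\boldsymbol\rho^n)$, $\boldsymbol\rho^{(2)}=\mathcal E_{t^{n+1}}(\boldsymbol\rho^{(1)})$, $\boldsymbol\rho^{n+1}=\frac12(\boldsymbol\rho^n+\boldsymbol\rho^{(2)})$. The approximate solution is $\rho^k_\Delta(t,x,y)=\rho^{k,n}_{i,j}$ for $(t,x,y)\in[t^n,t^{n+1})\times[x_{i-\frac12},x_{i+\frac12})\times[y_{j-\frac12},y_{j+\frac12})$. *)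

theory Defs
  imports "HOL-Analysis.Analysis" "HOL-Probability.Essential_Supremum"
begin

section \<open>Function spaces\<close>

text \<open>
  Continuously differentiable functions of order \<open>k\<close> on \<open>S\<close>. The derivatives are taken within
  \<open>S\<close>, so that on a set with boundary (such as a closed half space) they are one-sided at the
  boundary.
\<close>

primrec Ck_on :: "nat \<Rightarrow> 'a::euclidean_space set \<Rightarrow> ('a \<Rightarrow> real) \<Rightarrow> bool" where
  "Ck_on 0 S h \<longleftrightarrow> continuous_on S h"
| "Ck_on (Suc k) S h \<longleftrightarrow>
     (\<exists>D. (\<forall>z\<in>S. (h has_derivative D z) (at z within S)) \<and>
          (\<forall>v\<in>Basis. Ck_on k S (\<lambda>z. D z v)))"

definition Linf :: "'a measure \<Rightarrow> ('a \<Rightarrow> real) \<Rightarrow> bool" where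
  "Linf M h \<longleftrightarrow> h \<in> borel_measurable M \<and> esssup M (\<lambda>z. ereal \<bar>h z\<bar>) < \<infinity>"

definition Linf_norm :: "'a measure \<Rightarrow> ('a \<Rightarrow> real) \<Rightarrow> real" where
  "Linf_norm M h = real_of_ereal (esssup M (\<lambda>z. ereal \<bar>h z\<bar>))"

definition test_function :: "('a::euclidean_space \<Rightarrow> real) \<Rightarrow> bool" where
  "test_function \<phi> \<longleftrightarrow> (\<forall>k. Ck_on k UNIV \<phi>) \<and> compact (closure {z. \<phi> z \<noteq> 0})"

definition weak_partial ::
  "'a::euclidean_space \<Rightarrow> ('a \<Rightarrow> real) \<Rightarrow> ('a \<Rightarrow> real) \<Rightarrow> bool" where
  "weak_partial v h w \<longleftrightarrow>
     (\<forall>\<phi>. test_function \<phi> \<longrightarrow>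
        (LINT z|lebesgue. h z * frechet_derivative \<phi> (at z) v) = - (LINT z|lebesgue. w z * \<phi> z))"

definition W1inf :: "('a::euclidean_space \<Rightarrow> real) \<Rightarrow> bool" where
  "W1inf h \<longleftrightarrow> Linf lebesgue h \<and> (\<forall>v\<in>Basis. \<exists>w. Linf lebesgue w \<and> weak_partial v h w)"


section \<open>Flux functions and hypotheses\<close>

text \<open>
  The index ranges \<open>{1..N}\<close> and \<open>{1..m}\<close> are the finite types \<open>'n\<close> and \<open>'m\<close>. A flux function
  takes the arguments \<open>(t, x, y, \<rho>, A)\<close>; its values for \<open>t < 0\<close> are irrelevant.
\<close>

type_synonym 'm flux = "real \<times> real \<times> real \<times> real \<times> (real ^ 'm) \<Rightarrow> real"

definition flux_dom :: "(real \<times> real \<times> real \<times> real \<times> (real ^ 'm)) set" where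
  "flux_dom = {0..} \<times> UNIV"

definition d_x :: "'m flux \<Rightarrow> 'm flux" where
  "d_x h = (\<lambda>(t, x, y, r, A). deriv (\<lambda>s. h (t, s, y, r, A)) x)"

definition d_y :: "'m flux \<Rightarrow> 'm flux" where
  "d_y h = (\<lambda>(t, x, y, r, A). deriv (\<lambda>s. h (t, x, s, r, A)) y)"

definition d_rho :: "'m flux \<Rightarrow> 'm flux" where
  "d_rho h = (\<lambda>(t, x, y, r, A). deriv (\<lambda>s. h (t, x, y, s, A)) r)"

definition grad_A :: "'m::finite flux \<Rightarrow> real \<times> real \<times> real \<times> real \<times> (real ^ 'm) \<Rightarrow> real ^ 'm" where
  "grad_A h = (\<lambda>(t, x, y, r, A). \<chi> q. deriv (\<lambda>s. h (t, x, y, r, A + s *\<^sub>R axis q 1)) 0)"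

definition H0 :: "('n::finite \<Rightarrow> 'm::finite flux) \<Rightarrow> ('n \<Rightarrow> 'm flux) \<Rightarrow> bool" where
  "H0 f g \<longleftrightarrow>
     (\<forall>k. Ck_on 2 flux_dom (f k) \<and> Ck_on 2 flux_dom (g k) \<and>
          Linf (lebesgue_on flux_dom) (d_rho (f k)) \<and>
          Linf (lebesgue_on flux_dom) (d_rho (g k)) \<and>
          (\<forall>t x y A. t \<ge> 0 \<longrightarrow> f k (t, x, y, 0, A) = 0 \<and> g k (t, x, y, 0, A) = 0))"

text \<open>Vectors in \<open>\<real>\<^sup>m\<close> are measured in the maximum norm \<^const>\<open>infnorm\<close>.\<close>

definition H1 :: "('n::finite \<Rightarrow> 'm::finite flux) \<Rightarrow> ('n \<Rightarrow> 'm flux) \<Rightarrow> real \<Rightarrow> bool" where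
  "H1 f g M \<longleftrightarrow>
     (\<forall>k t x y r A. t \<ge> 0 \<longrightarrow>
        \<bar>d_x (f k) (t, x, y, r, A)\<bar> \<le> M * \<bar>r\<bar> \<and>
        infnorm (grad_A (f k) (t, x, y, r, A)) \<le> M * \<bar>r\<bar> \<and>
        \<bar>d_y (g k) (t, x, y, r, A)\<bar> \<le> M * \<bar>r\<bar> \<and>
        infnorm (grad_A (g k) (t, x, y, r, A)) \<le> M * \<bar>r\<bar>)"

definition H2 ::
  "('m::finite \<Rightarrow> 'n::finite \<Rightarrow> real \<times> real \<Rightarrow> real) \<Rightarrow> ('m \<Rightarrow> 'n \<Rightarrow> real \<times> real \<Rightarrow> real) \<Rightarrow> bool"
where
  "H2 \<eta> \<nu> \<longleftrightarrow>
     (\<forall>q k. Ck_on 2 UNIV (\<eta> q k) \<and> W1inf (\<eta> q k) \<and> Ck_on 2 UNIV (\<nu> q k) \<and> W1inf (\<nu> q k))"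


section \<open>The second-order scheme\<close>

definition minmod :: "real list \<Rightarrow> real" where
  "minmod as =
     (if \<forall>a\<in>set as. sgn a = sgn (hd as) then sgn (hd as) * Min (abs ` set as) else 0)"

definition numerical_flux :: "(real \<Rightarrow> real) \<Rightarrow> real \<Rightarrow> real \<Rightarrow> real \<Rightarrow> real \<Rightarrow> real" where
  "numerical_flux h \<alpha> lam u v = (h u + h v) / 2 - \<alpha> * (v - u) / (2 * lam)"

type_synonym 'n grid_fun = "'n \<Rightarrow> int \<Rightarrow> int \<Rightarrow> real"

text \<open>
  Quantities attached to cell faces carry the index of the cell to the left of (below) the face:
  in \<open>x\<close>-direction the index pair \<open>i j\<close> stands for the face \<open>(i + 1/2, j)\<close>, in \<open>y\<close>-direction for
  the face \<open>(i, j + 1/2)\<close>.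
\<close>

locale nonlocal_scheme =
  fixes f g :: "'n::finite \<Rightarrow> 'm::finite flux"
    and \<eta> \<nu> :: "'m \<Rightarrow> 'n \<Rightarrow> real \<times> real \<Rightarrow> real"
    and \<theta> \<alpha> \<beta> dx dy dt :: real
    and \<rho>0 :: "'n \<Rightarrow> real \<times> real \<Rightarrow> real"
begin

definition lam_x :: real where "lam_x = dt / dx"
definition lam_y :: real where "lam_y = dt / dy"

definition slope_x :: "(int \<Rightarrow> int \<Rightarrow> real) \<Rightarrow> int \<Rightarrow> int \<Rightarrow> real" where
  "slope_x r i j =
     2 * \<theta> * minmod [r i j - r (i - 1) j, (r (i + 1) j - r (i - 1) j) / 2, r (i + 1) j - r i j]"

definition slope_y :: "(int \<Rightarrow> int \<Rightarrow> real) \<Rightarrow> int \<Rightarrow> int \<Rightarrow> real" where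
  "slope_y r i j =
     2 * \<theta> * minmod [r i j - r i (j - 1), (r i (j + 1) - r i (j - 1)) / 2, r i (j + 1) - r i j]"

definition face_x_minus :: "(int \<Rightarrow> int \<Rightarrow> real) \<Rightarrow> int \<Rightarrow> int \<Rightarrow> real" where
  "face_x_minus r i j = r i j + slope_x r i j / 2"

definition face_x_plus :: "(int \<Rightarrow> int \<Rightarrow> real) \<Rightarrow> int \<Rightarrow> int \<Rightarrow> real" where
  "face_x_plus r i j = r (i + 1) j - slope_x r (i + 1) j / 2"

definition face_y_minus :: "(int \<Rightarrow> int \<Rightarrow> real) \<Rightarrow> int \<Rightarrow> int \<Rightarrow> real" where
  "face_y_minus r i j = r i j + slope_y r i j / 2"

definition face_y_plus :: "(int \<Rightarrow> int \<Rightarrow> real) \<Rightarrow> int \<Rightarrow> int \<Rightarrow> real" where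
  "face_y_plus r i j = r i (j + 1) - slope_y r i (j + 1) / 2"

text \<open>
  Under \<^const>\<open>H2\<close> the sums over \<open>\<int> \<times> \<int>\<close> converge absolutely: the kernels are bounded and
  the grid functions of the scheme are summable.
\<close>

definition conv_A :: "'n grid_fun \<Rightarrow> int \<Rightarrow> int \<Rightarrow> real ^ 'm" where
  "conv_A \<rho> i j = (\<chi> q. dx * dy * (\<Sum>k\<in>UNIV. \<Sum>\<^sub>\<infinity>(l, p)\<in>UNIV.
     \<eta> q k ((of_int i + 1/2) * dx - of_int l * dx, of_int j * dy - of_int p * dy) * \<rho> k l p))"

definition conv_B :: "'n grid_fun \<Rightarrow> int \<Rightarrow> int \<Rightarrow> real ^ 'm" where
  "conv_B \<rho> i j = (\<chi> q. dx * dy * (\<Sum>k\<in>UNIV. \<Sum>\<^sub>\<infinity>(l, p)\<in>UNIV.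
     \<nu> q k (of_int i * dx - of_int l * dx, (of_int j + 1/2) * dy - of_int p * dy) * \<rho> k l p))"

definition flux_F :: "real \<Rightarrow> 'n grid_fun \<Rightarrow> 'n \<Rightarrow> int \<Rightarrow> int \<Rightarrow> real" where
  "flux_F \<tau> \<rho> k i j =
     numerical_flux (\<lambda>u. f k (\<tau>, (of_int i + 1/2) * dx, of_int j * dy, u, conv_A \<rho> i j)) \<alpha> lam_x
       (face_x_minus (\<rho> k) i j) (face_x_plus (\<rho> k) i j)"

definition flux_G :: "real \<Rightarrow> 'n grid_fun \<Rightarrow> 'n \<Rightarrow> int \<Rightarrow> int \<Rightarrow> real" where
  "flux_G \<tau> \<rho> k i j =
     numerical_flux (\<lambda>u. g k (\<tau>, of_int i * dx, (of_int j + 1/2) * dy, u, conv_B \<rho> i j)) \<beta> lam_y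
       (face_y_minus (\<rho> k) i j) (face_y_plus (\<rho> k) i j)"

definition euler_step :: "real \<Rightarrow> 'n grid_fun \<Rightarrow> 'n grid_fun" where
  "euler_step \<tau> \<rho> = (\<lambda>k i j. \<rho> k i j
     - lam_x * (flux_F \<tau> \<rho> k i j - flux_F \<tau> \<rho> k (i - 1) j)
     - lam_y * (flux_G \<tau> \<rho> k i j - flux_G \<tau> \<rho> k i (j - 1)))"

definition cell :: "int \<Rightarrow> int \<Rightarrow> (real \<times> real) set" where
  "cell i j = {(of_int i - 1/2) * dx ..< (of_int i + 1/2) * dx}
            \<times> {(of_int j - 1/2) * dy ..< (of_int j + 1/2) * dy}"

definition initial_averages :: "'n grid_fun" where
  "initial_averages = (\<lambda>k i j. (LINT z:cell i j|lebesgue. \<rho>0 k z) / (dx * dy))"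

primrec scheme :: "nat \<Rightarrow> 'n grid_fun" where
  "scheme 0 = initial_averages"
| "scheme (Suc n) =
     (let \<rho> = scheme n;
          \<rho>1 = euler_step (real n * dt) \<rho>;
          \<rho>2 = euler_step (real (Suc n) * dt) \<rho>1
      in (\<lambda>k i j. (\<rho> k i j + \<rho>2 k i j) / 2))"

text \<open>
  The approximate solution picks the time level and the cell containing \<open>(t, x, y)\<close>;
  see \<open>rho_Delta_cell\<close> below.
\<close>

definition rho_Delta :: "'n \<Rightarrow> real \<Rightarrow> real \<Rightarrow> real \<Rightarrow> real" where
  "rho_Delta k t x y = scheme (nat \<lfloor>t / dt\<rfloor>) k \<lfloor>x / dx + 1/2\<rfloor> \<lfloor>y / dy + 1/2\<rfloor>"

lemma rho_Delta_cell:
  assumes "dx > 0" "dy > 0" "dt > 0"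
    and t: "t \<in> {real n * dt ..< real (Suc n) * dt}" and xy: "(x, y) \<in> cell i j"
  shows "rho_Delta k t x y = scheme n k i j"
proof -
  have "\<lfloor>t / dt\<rfloor> = int n"
    using assms by (intro floor_unique) (auto simp: field_simps)
  moreover have "\<lfloor>x / dx + 1/2\<rfloor> = i" "\<lfloor>y / dy + 1/2\<rfloor> = j"
    using assms by (auto simp: cell_def field_simps intro!: floor_unique)
  ultimately show ?thesis
    by (simp add: rho_Delta_def)
qed

end

end

theory Submission
  imports Defs
begin

text \<open>
  Since the fluxes vanish at \<open>\<rho> = 0\<close> and \<open>\<partial>\<^sub>\<rho> f\<close> is continuous, \<open>\<bar>f(\<tau>, x, y, u, A)\<bar> \<le> L \<bar>u\<bar>\<close> with
  \<open>L\<close> the \<open>L\<^sup>\<infinity>\<close> norm of \<open>\<partial>\<^sub>\<rho> f\<close>, whatever the other arguments. The limiter keeps the face values of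
  a nonnegative grid function nonnegative, and the two face values of a cell add up to twice the
  cell value. In an Euler step half of the cell value therefore pays for the \<open>x\<close>-fluxes and half for
  the \<open>y\<close>-fluxes: the two faces of the cell cost at most \<open>(\<alpha> + \<lambda> L) \<rho>\<close>, while the contributions
  of the neighbouring cells have the right sign as soon as \<open>\<lambda> L \<le> \<alpha>\<close>.
\<close>

section \<open>Fluxes grow at most linearly in the density\<close>

lemma AE_Linf_norm_bound:
  assumes "Linf M h"
  shows "AE z in M. \<bar>h z\<bar> \<le> Linf_norm M h"
proof -
  let ?E = "esssup M (\<lambda>z. ereal \<bar>h z\<bar>)"
  have fin: "?E < \<infinity>" and "h \<in> borel_measurable M"
    using assms by (auto simp: Linf_def)
  then have "AE z in M. ereal \<bar>h z\<bar> \<le> ?E"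
    by (intro esssup_AE) measurable
  then show ?thesis
    unfolding Linf_norm_def
    by (rule AE_mp) (use fin in \<open>cases ?E; auto\<close>)
qed

text \<open>A violation at an interior point would persist on a nonempty open set, which is never
  negligible. The interior is dense in \<open>S\<close>, so continuity carries the bound to the
  boundary, for \<open>flux_dom\<close> the slice t = 0.\<close>

lemma AE_le_imp_le_on_closed_convex:
  fixes h :: "'a::euclidean_space \<Rightarrow> real"
  assumes S: "closed S" "convex S" "interior S \<noteq> {}"
    and h: "continuous_on S h"
    and ae: "AE z in lebesgue_on S. h z \<le> c"
    and z: "z \<in> S"
  shows "h z \<le> c"
proof -
  have cl: "closure (interior S) = S"
    using S by (simp add: convex_closure_interior)
  have int: "h w \<le> c" if w: "w \<in> interior S" for w
  proof (rule ccontr)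
    assume "\<not> h w \<le> c"
    define U where "U = interior S \<inter> h -` {c<..}"
    have "continuous_on (interior S) h"
      using h interior_subset continuous_on_subset by blast
    then have "open U"
      unfolding U_def by (intro continuous_open_preimage) auto
    moreover have "U \<noteq> {}"
      using w \<open>\<not> h w \<le> c\<close> by (auto simp: U_def)
    ultimately have "\<not> negligible U"
      by (rule open_not_negligible)
    moreover have "AE z in lebesgue. z \<in> S \<longrightarrow> h z \<le> c"
      using ae S by (subst (asm) AE_restrict_space_iff) auto
    then have "AE z in lebesgue. z \<notin> U"
      by (rule AE_mp) (use interior_subset[of S] in \<open>auto simp: U_def\<close>)
    then have "negligible U"
      using \<open>open U\<close> by (subst negligible_iff_null_sets, subst AE_iff_null_sets) auto
    ultimately show False by simp
  qed
  show ?thesis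
    by (rule continuous_le_on_closure[where S = "interior S"]) (use int h z cl in auto)
qed

section \<open>The flux domain and the density derivative\<close>

lemma mem_flux_dom [simp]: "(t, x, y, r, A) \<in> flux_dom \<longleftrightarrow> 0 \<le> t"
  by (simp add: flux_dom_def)

lemma closed_flux_dom: "closed flux_dom"
  unfolding flux_dom_def by (intro closed_Times) auto

lemma convex_flux_dom: "convex flux_dom"
  unfolding flux_dom_def by (intro convex_Times) auto

lemma interior_flux_dom_nonempty: "interior flux_dom \<noteq> {}"
  unfolding flux_dom_def by (simp add: interior_Times)

text \<open>Lets regularity pass to \<open>d_rho h\<close>, which is identified with a component of
  the derivative only on \<open>flux_dom\<close>.\<close>

lemma Ck_on_cong:
  assumes "\<And>z. z \<in> S \<Longrightarrow> h z = h' z"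
  shows "Ck_on k S h \<longleftrightarrow> Ck_on k S h'"
proof (cases k)
  case 0
  then show ?thesis using assms by (simp cong: continuous_on_cong)
next
  case (Suc l)
  have "(h has_derivative D) (at z within S) \<longleftrightarrow> (h' has_derivative D) (at z within S)"
    if "z \<in> S" for z D
    using that assms
    by (auto intro: has_derivative_transform[of z S h' h] has_derivative_transform[of z S h h'])
  then show ?thesis
    by (simp add: Suc)
qed

lemma
  fixes h :: "'m::finite flux"
  assumes "Ck_on (Suc k) flux_dom h"
  shows has_derivative_d_rho:
      "0 \<le> t \<Longrightarrow> ((\<lambda>s. h (t, x, y, s, A)) has_real_derivative d_rho h (t, x, y, r, A)) (at r)"
    and Ck_on_d_rho: "Ck_on k flux_dom (d_rho h)"
proof -
  let ?v = "(0, 0, 0, 1, 0) :: real \<times> real \<times> real \<times> real \<times> (real ^ 'm)"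
  obtain D where D: "\<And>z. z \<in> flux_dom \<Longrightarrow> (h has_derivative D z) (at z within flux_dom)"
    and cont: "\<And>v. v \<in> Basis \<Longrightarrow> Ck_on k flux_dom (\<lambda>z. D z v)"
    using assms by auto
  have deriv: "((\<lambda>s. h (t, x, y, s, A)) has_real_derivative D (t, x, y, r, A) ?v) (at r)"
    if "0 \<le> t" for t x y r and A :: "real ^ 'm"
  proof -
    have p: "((\<lambda>s. (t, x, y, s, A)) has_derivative (\<lambda>s. (0, 0, 0, s, 0))) (at r)"
      by (auto intro!: derivative_eq_intros)
    \<comment> \<open>The full line in the density direction stays in the domain, so the derivative
      within \<open>flux_dom\<close> restricts to a two-sided one, even at t = 0.\<close>
    have "(h has_derivative D (t, x, y, r, A))
        (at (t, x, y, r, A) within (\<lambda>s. (t, x, y, s, A)) ` UNIV)"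
      by (rule has_derivative_subset[OF D]) (use that in auto)
    from diff_chain_within[OF p this]
    have "((\<lambda>s. h (t, x, y, s, A)) has_derivative (\<lambda>s. D (t, x, y, r, A) (0, 0, 0, s, 0))) (at r)"
      by (simp add: o_def)
    moreover have "(\<lambda>s. D (t, x, y, r, A) (0, 0, 0, s, 0)) = (*) (D (t, x, y, r, A) ?v)"
    proof
      show "D (t, x, y, r, A) (0, 0, 0, s, 0) = D (t, x, y, r, A) ?v * s" for s
        using linear_scale[OF has_derivative_linear[OF D], of "(t, x, y, r, A)" s ?v] that
        by simp
    qed
    ultimately show ?thesis
      unfolding has_field_derivative_def by simp
  qed
  have eq: "D z ?v = d_rho h z" if "z \<in> flux_dom" for z
    using that by (cases z) (auto simp: d_rho_def intro!: DERIV_imp_deriv[symmetric] deriv)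
  show "((\<lambda>s. h (t, x, y, s, A)) has_real_derivative d_rho h (t, x, y, r, A)) (at r)"
    if "0 \<le> t"
    using deriv[OF that, where x = x and y = y and r = r and A = A] eq[of "(t, x, y, r, A)"] that
    by simp
  have "Ck_on k flux_dom (\<lambda>z. D z ?v)"
    by (rule cont) (auto simp: Basis_prod_def)
  then show "Ck_on k flux_dom (d_rho h)"
    using Ck_on_cong[of flux_dom "\<lambda>z. D z ?v" "d_rho h" k] eq by blast
qed

text \<open>Mean value inequality between 0 and \<open>r\<close>; continuity of
  \<open>d_rho h\<close> first turns its essential bound into a pointwise one.\<close>

lemma abs_flux_le:
  fixes h :: "'m::finite flux"
  assumes C2: "Ck_on 2 flux_dom h" and Linf: "Linf (lebesgue_on flux_dom) (d_rho h)"
    and zero: "h (t, x, y, 0, A) = 0" and t: "0 \<le> t"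
  shows "\<bar>h (t, x, y, r, A)\<bar> \<le> Linf_norm (lebesgue_on flux_dom) (d_rho h) * \<bar>r\<bar>"
proof -
  let ?L = "Linf_norm (lebesgue_on flux_dom) (d_rho h)"
  have C: "Ck_on (Suc 1) flux_dom h"
    using C2 by (simp add: numeral_2_eq_2)
  have "continuous_on flux_dom (d_rho h)"
    using Ck_on_d_rho[OF C] by (auto intro: has_derivative_continuous_on)
  then have "continuous_on flux_dom (\<lambda>z. \<bar>d_rho h z\<bar>)"
    by (rule continuous_on_rabs)
  then have bound: "\<bar>d_rho h z\<bar> \<le> ?L" if "z \<in> flux_dom" for z
    using AE_le_imp_le_on_closed_convex[OF closed_flux_dom convex_flux_dom
        interior_flux_dom_nonempty _ AE_Linf_norm_bound[OF Linf] that] by blast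
  have "norm (h (t, x, y, r, A) - h (t, x, y, 0, A)) \<le> ?L * norm (r - 0)"
  proof (rule field_differentiable_bound[OF convex_UNIV])
    show "((\<lambda>s. h (t, x, y, s, A)) has_field_derivative d_rho h (t, x, y, s, A)) (at s within UNIV)"
      for s using has_derivative_d_rho[OF C t] by simp
    show "norm (d_rho h (t, x, y, s, A)) \<le> ?L" for s
      using bound[of "(t, x, y, s, A)"] t by simp
  qed auto
  then show ?thesis using zero by simp
qed

section \<open>Positivity of the Euler step\<close>

text \<open>If all arguments are positive, the minimum is at most r - rl \<le> r; if all are
  negative, at most r - rr \<le> r.\<close>

lemma abs_minmod_le:
  assumes "0 \<le> r" "0 \<le> rl" "0 \<le> rr"
  shows "\<bar>minmod [r - rl, (rr - rl) / 2, rr - r]\<bar> \<le> r"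
  using assms by (auto simp: minmod_def sgn_if split: if_splits)

lemma limited_slope_bounds:
  assumes "0 \<le> r" "0 \<le> rl" "0 \<le> rr" "0 \<le> \<theta>" "\<theta> \<le> 1"
  shows "\<bar>2 * \<theta> * minmod [r - rl, (rr - rl) / 2, rr - r] / 2\<bar> \<le> (r :: real)"
proof -
  have "\<theta> * \<bar>minmod [r - rl, (rr - rl) / 2, rr - r]\<bar> \<le> 1 * r"
    using assms abs_minmod_le by (intro mult_mono) auto
  then show ?thesis
    using assms by (simp add: abs_mult)
qed

text \<open>
  Here \<open>h\<close> and \<open>h'\<close> are the fluxes at the right and left face of a cell with value \<open>r\<close> and face
  values \<open>a\<close> and \<open>b\<close>; \<open>c\<close> and \<open>d\<close> are the face values on the outer sides.
\<close>

lemma flux_difference_le: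
  assumes h: "\<And>u. \<bar>h u\<bar> \<le> L * \<bar>u\<bar>" and h': "\<And>u. \<bar>h' u\<bar> \<le> L * \<bar>u\<bar>"
    and pos: "0 \<le> a" "0 \<le> b" "0 \<le> c" "0 \<le> d" and ab: "a + b = 2 * r"
    and lam: "0 < lam" "lam * L \<le> \<alpha>" "\<alpha> + lam * L \<le> 1 / 2"
  shows "lam * (numerical_flux h \<alpha> lam a c - numerical_flux h' \<alpha> lam d b) \<le> r / 2"
proof -
  \<comment> \<open>The numerical viscosity is negative in the outer values \<open>c\<close>,
    \<open>d\<close> and positive in the cell's own values \<open>a\<close>,
    \<open>b\<close>.\<close>
  have "lam * (numerical_flux h \<alpha> lam a c - numerical_flux h' \<alpha> lam d b)
      = lam * (h a - h' d + h c - h' b) / 2 - \<alpha> * (c + d) / 2 + \<alpha> * (a + b) / 2"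
    using lam by (simp add: numerical_flux_def field_simps)
  also have "lam * (h a - h' d + h c - h' b) \<le> lam * (L * (a + b) + L * (c + d))"
    using h[of a] h[of c] h'[of b] h'[of d] pos lam
    by (intro mult_left_mono) (auto simp: algebra_simps)
  also have "\<dots> = (lam * L) * (a + b) + (lam * L) * (c + d)"
    by (simp add: algebra_simps)
  \<comment> \<open>Here the viscosity absorbs the outer flux contributions.\<close>
  also have "(lam * L) * (c + d) \<le> \<alpha> * (c + d)"
    using lam pos by (intro mult_right_mono) auto
  finally have "lam * (numerical_flux h \<alpha> lam a c - numerical_flux h' \<alpha> lam d b)
      \<le> (\<alpha> + lam * L) * (a + b) / 2"
    by (simp add: field_simps)
  also have "\<dots> \<le> 1 / 2 * (a + b) / 2"
    using lam pos by (intro divide_right_mono mult_right_mono) auto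
  finally show ?thesis using ab by simp
qed

text \<open>After clearing the denominator and dividing by 12, the third entry of the minimum gives
  (1 + \<theta>) lam L \<le> \<alpha> and the second gives (1 + \<theta>) (\<alpha> + lam L) \<le>
  1/3. The factor 1 + \<theta> \<ge> 1 can then be dropped.\<close>

lemma CFL_bounds:
  fixes lam L \<alpha> \<theta> :: real
  assumes cfl: "2 * lam \<le> Min {1, 4 - 6 * (2 * \<alpha>) * (1 + \<theta>), 6 * (2 * \<alpha>)} / (6 * (1 + \<theta>) * L + 1)"
    and lam: "0 < lam" and L: "0 \<le> L" and \<theta>: "0 \<le> \<theta>"
  shows "lam * L \<le> \<alpha>" and "\<alpha> + lam * L \<le> 1 / 2"
proof -
  have "0 \<le> \<theta> * L" using L \<theta> by simp
  then have "0 < 6 * (1 + \<theta>) * L + 1"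
    using L by (simp add: algebra_simps)
  then have "2 * lam * (6 * (1 + \<theta>) * L + 1) \<le> Min {1, 4 - 6 * (2 * \<alpha>) * (1 + \<theta>), 6 * (2 * \<alpha>)}"
    using cfl by (simp add: pos_le_divide_eq)
  then have *: "12 * ((1 + \<theta>) * (lam * L)) + 2 * lam \<le> 4 - 12 * ((1 + \<theta>) * \<alpha>)"
      "12 * ((1 + \<theta>) * (lam * L)) + 2 * lam \<le> 12 * \<alpha>"
    by (auto simp: algebra_simps)
  have mono: "x \<le> (1 + \<theta>) * x" if "0 \<le> x" for x
    using that \<theta> by (simp add: algebra_simps)
  have "0 \<le> lam * L" using lam L by simp
  with mono[OF this] *(2) lam show "lam * L \<le> \<alpha>" by linarith
  then have "0 \<le> \<alpha> + lam * L" using \<open>0 \<le> lam * L\<close> by linarith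
  from mono[OF this] *(1) lam show "\<alpha> + lam * L \<le> 1 / 2"
    by (simp add: algebra_simps)
qed

section \<open>Positivity on the grid\<close>

context nonlocal_scheme
begin

lemma face_x_nonneg:
  assumes "\<And>i j. 0 \<le> r i j" "0 \<le> \<theta>" "\<theta> \<le> 1"
  shows "0 \<le> face_x_minus r i j" "0 \<le> face_x_plus r i j"
  using limited_slope_bounds[of "r i j" "r (i - 1) j" "r (i + 1) j" \<theta>]
    limited_slope_bounds[of "r (i + 1) j" "r (i + 1 - 1) j" "r (i + 1 + 1) j" \<theta>] assms
  by (auto simp: face_x_minus_def face_x_plus_def slope_x_def abs_le_iff)

lemma face_y_nonneg:
  assumes "\<And>i j. 0 \<le> r i j" "0 \<le> \<theta>" "\<theta> \<le> 1"
  shows "0 \<le> face_y_minus r i j" "0 \<le> face_y_plus r i j"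
  using limited_slope_bounds[of "r i j" "r i (j - 1)" "r i (j + 1)" \<theta>]
    limited_slope_bounds[of "r i (j + 1)" "r i (j + 1 - 1)" "r i (j + 1 + 1)" \<theta>] assms
  by (auto simp: face_y_minus_def face_y_plus_def slope_y_def abs_le_iff)

lemma euler_step_nonneg:
  assumes \<rho>: "\<And>k i j. 0 \<le> \<rho> k i j" and \<theta>: "0 \<le> \<theta>" "\<theta> \<le> 1"
    and f: "\<And>x y u A. \<bar>f k (\<tau>, x, y, u, A)\<bar> \<le> Lf * \<bar>u\<bar>"
    and g: "\<And>x y u A. \<bar>g k (\<tau>, x, y, u, A)\<bar> \<le> Lg * \<bar>u\<bar>"
    and x: "0 < lam_x" "lam_x * Lf \<le> \<alpha>" "\<alpha> + lam_x * Lf \<le> 1 / 2"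
    and y: "0 < lam_y" "lam_y * Lg \<le> \<beta>" "\<beta> + lam_y * Lg \<le> 1 / 2"
  shows "0 \<le> euler_step \<tau> \<rho> k i j"
proof -
  note nn = face_x_nonneg[of "\<rho> k", OF \<rho> \<theta>] face_y_nonneg[of "\<rho> k", OF \<rho> \<theta>]
  \<comment> \<open>The cell's own face values are \<open>face_x_minus\<close> at i and
    \<open>face_x_plus\<close> at i - 1. Both use the slope of cell i with opposite signs, so they
    sum to twice the cell value.\<close>
  have "lam_x * (flux_F \<tau> \<rho> k i j - flux_F \<tau> \<rho> k (i - 1) j) \<le> \<rho> k i j / 2"
    unfolding flux_F_def
    by (rule flux_difference_le[OF f f nn(1,2,2,1) _ x])
      (simp add: face_x_minus_def face_x_plus_def)
  moreover have "lam_y * (flux_G \<tau> \<rho> k i j - flux_G \<tau> \<rho> k i (j - 1)) \<le> \<rho> k i j / 2"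
    unfolding flux_G_def
    by (rule flux_difference_le[OF g g nn(3,4,4,3) _ y])
      (simp add: face_y_minus_def face_y_plus_def)
  ultimately show ?thesis
    by (simp add: euler_step_def)
qed

lemma initial_averages_nonneg:
  assumes "0 < dx" "0 < dy" "AE z in lebesgue. 0 \<le> \<rho>0 k z"
  shows "0 \<le> initial_averages k i j"
proof -
  have "AE z in lebesgue. 0 \<le> indicator (cell i j) z *\<^sub>R \<rho>0 k z"
    using assms(3) by (rule AE_mp) (auto simp: indicator_def)
  then have "0 \<le> (LINT z:cell i j|lebesgue. \<rho>0 k z)"
    unfolding set_lebesgue_integral_def by (rule integral_nonneg_AE)
  then show ?thesis
    using assms by (simp add: initial_averages_def)
qed

text \<open>The new level averages the old one with two successive Euler steps. \<open>step\<close>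
  covers arbitrary nonnegative grid functions because the second Euler step starts from the
  intermediate stage.\<close>

lemma scheme_nonneg:
  assumes init: "\<And>k i j. 0 \<le> initial_averages k i j" and dt: "0 \<le> dt"
    and step: "\<And>\<tau> \<rho> k i j. 0 \<le> \<tau> \<Longrightarrow> (\<And>k i j. 0 \<le> \<rho> k i j) \<Longrightarrow> 0 \<le> euler_step \<tau> \<rho> k i j"
  shows "0 \<le> scheme n k i j"
proof (induction n arbitrary: k i j)
  case 0
  then show ?case using init by simp
next
  case (Suc n)
  have "0 \<le> euler_step (real n * dt) (scheme n) k i j" for k i j
    using dt by (intro step Suc.IH) auto
  from step[OF _ this] have
    "0 \<le> euler_step (real (Suc n) * dt) (euler_step (real n * dt) (scheme n)) k i j"
    using dt by simp
  with Suc show ?case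
    by (simp add: Let_def)
qed

end

theorem theorem1:
  fixes f g :: "'n::finite \<Rightarrow> 'm::finite flux"
    and \<eta> \<nu> :: "'m \<Rightarrow> 'n \<Rightarrow> real \<times> real \<Rightarrow> real"
    and \<theta> \<alpha> \<beta> dx dy dt M :: real
    and \<rho>0 :: "'n \<Rightarrow> real \<times> real \<Rightarrow> real"
  assumes "H0 f g"
    and "M > 0" and "H1 f g M"
    and "H2 \<eta> \<nu>"
    and "\<theta> \<in> {0..1}"
    and "\<alpha> \<in> {0 <..< 1 / (3 * (1 + \<theta>))}" and "\<beta> \<in> {0 <..< 1 / (3 * (1 + \<theta>))}"
    and "dx > 0" and "dy > 0" and "dt > 0"
    and "\<And>k. 2 * (dt / dx) \<le> Min {1, 4 - 6 * (2 * \<alpha>) * (1 + \<theta>), 6 * (2 * \<alpha>)}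
               / (6 * (1 + \<theta>) * Linf_norm (lebesgue_on flux_dom) (d_rho (f k)) + 1)"
    and "\<And>k. 2 * (dt / dy) \<le> Min {1, 4 - 6 * (2 * \<beta>) * (1 + \<theta>), 6 * (2 * \<beta>)}
               / (6 * (1 + \<theta>) * Linf_norm (lebesgue_on flux_dom) (d_rho (g k)) + 1)"
    and "dx \<le> 1 / (3 * M)" and "dy \<le> 1 / (3 * M)"
    and "\<And>k. integrable lebesgue (\<rho>0 k)" and "\<And>k. Linf lebesgue (\<rho>0 k)"
    and "\<And>k. AE z in lebesgue. \<rho>0 k z \<ge> 0"
  shows "\<forall>k t x y. t \<ge> 0 \<longrightarrow>
           nonlocal_scheme.rho_Delta f g \<eta> \<nu> \<theta> \<alpha> \<beta> dx dy dt \<rho>0 k t x y \<ge> 0"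
proof -
  interpret nonlocal_scheme f g \<eta> \<nu> \<theta> \<alpha> \<beta> dx dy dt \<rho>0 .
  define Lf where "Lf k = Linf_norm (lebesgue_on flux_dom) (d_rho (f k))" for k
  define Lg where "Lg k = Linf_norm (lebesgue_on flux_dom) (d_rho (g k))" for k
  have \<theta>: "0 \<le> \<theta>" "\<theta> \<le> 1" using \<open>\<theta> \<in> {0..1}\<close> by auto
  have f: "\<bar>f k (\<tau>, x, y, u, A)\<bar> \<le> Lf k * \<bar>u\<bar>" and g: "\<bar>g k (\<tau>, x, y, u, A)\<bar> \<le> Lg k * \<bar>u\<bar>"
    if "0 \<le> \<tau>" for k \<tau> x y u A
    unfolding Lf_def Lg_def using \<open>H0 f g\<close> that by (auto simp: H0_def intro!: abs_flux_le)
  \<comment> \<open>At u = 1 the linear bound dominates an absolute value by the constant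
    itself.\<close>
  have L: "0 \<le> Lf k" "0 \<le> Lg k" for k
    using order_trans[OF abs_ge_zero f[of 0 k _ _ 1]]
      order_trans[OF abs_ge_zero g[of 0 k _ _ 1]] by auto
  have lam: "0 < lam_x" "0 < lam_y"
    using \<open>dx > 0\<close> \<open>dy > 0\<close> \<open>dt > 0\<close> by (auto simp: lam_x_def lam_y_def)
  note x = CFL_bounds[OF assms(11)[folded lam_x_def Lf_def] lam(1) L(1) \<theta>(1)]
  note y = CFL_bounds[OF assms(12)[folded lam_y_def Lg_def] lam(2) L(2) \<theta>(1)]
  have "0 \<le> euler_step \<tau> \<rho> k i j" if "0 \<le> \<tau>" "\<And>k i j. 0 \<le> \<rho> k i j" for \<tau> \<rho> k i j
    by (rule euler_step_nonneg[OF that(2) \<theta> f[OF that(1)] g[OF that(1)] lam(1) x lam(2) y])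
  then have "0 \<le> scheme n k i j" for n k i j
    using assms by (intro scheme_nonneg initial_averages_nonneg) auto
  then show ?thesis
    by (simp add: rho_Delta_def)
qed

end
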